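(* Let $n\ge 3$. Let $U\subset\mathcal S^{n\times n}$ be an open set such that $M+N\in U$ whenever $M\in U$ and $N\in\mathcal S^{n\times n}_+$, and $aM\in U$ whenever $M\in U$ and $a>0$. Assume that there exists some $\eta\in C^2(B_2\setminus\{0\})\cap C^0(B_2)$ satisfying $$\eta(0)=0,\qquad \eta(x)>0\quad\forall x\in B_2\setminus\{0\},$$ $$D^2\eta(x)\ \text{does not belong to } U,\qquad\forall x\in B_2\setminus\{0\}.$$ Suppose that $\xi\in C^0_{loc}(B_2\setminus\{0\})\cap L^\infty(B_2\setminus\{0\})$ satisfies $\xi>0$ in $B_2\setminus\{0\}$ and $\Delta\xi\ge 0$ in $B_2\setminus\{0\}$ in the distribution sense, and that there exist $\{\xi_i\}$ in $C^2(B_2\setminus\{0\})$ such that $$\Delta\xi_i\ge 0,\quad D^2\xi_i\in\overline U\quad\text{in } B_2\setminus\{0\},\qquad \xi_i\to\xi\ \text{ in } C^0_{loc}(B_2\setminus\{0\}).$$ Then $\xi$ can be extended as a function in $C^0(B_1)$ which satisfies $$\sup_{B_1\setminus\{0\}}\xi\le\max_{\partial B_1}\xi,$$ $$|\xi(x)-\xi(y)|\le C(\eta)\left[\sup_{B_1\setminus\{0\}}\xi-\inf_{B_1\setminus\{0\}}\xi\right]\left[\eta(x-y)+\eta(y-x)\right],\qquad\forall x,y\in B_{1/4},$$ where $C(\eta)$ is some positive constant depending only on $\eta$.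
   Context: $\mathcal S^{n\times n}$ is the set of real symmetric $n\times n$ matrices, $\mathcal S^{n\times n}_+$ the subset of positive definite ones, $\overline U$ the closure of $U$. $B_a\subset\mathbb R^n$ is the ball of radius $a$ centered at the origin. $D^2$ denotes the Hessian. $C^0_{loc}$ convergence means uniform convergence on compact subsets. *)

theory Defs
  imports "HOL-Analysis.Analysis"
begin

definition sym_matrices :: "(real^'n^'n) set" where
  "sym_matrices = {M. transpose M = M}"

definition posdef_matrices :: "(real^'n^'n) set" where
  "posdef_matrices = {M \<in> sym_matrices. \<forall>v. v \<noteq> 0 \<longrightarrow> v \<bullet> (M *v v) > 0}"

(* Openness is relative to the space of symmetric matrices, which has empty interior among
   all matrices when there are at least two indices. It includes U \<subseteq> sym_matrices. As
   sym_matrices is closed, the relative closure of U is the plain closure U. *)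
definition elliptic_cone :: "(real^'n^'n) set \<Rightarrow> bool" where
  "elliptic_cone U \<longleftrightarrow>
     openin (top_of_set sym_matrices) U \<and>
     (\<forall>M\<in>U. \<forall>N\<in>posdef_matrices. M + N \<in> U) \<and>
     (\<forall>M\<in>U. \<forall>a>0. a *\<^sub>R M \<in> U)"

definition pderiv_at :: "'n \<Rightarrow> (real^'n \<Rightarrow> real) \<Rightarrow> real^'n \<Rightarrow> real" where
  "pderiv_at i f x = frechet_derivative f (at x) (axis i 1)"

(* To be used for open S only. *)
primrec Ck_on :: "nat \<Rightarrow> (real^'n) set \<Rightarrow> (real^'n \<Rightarrow> real) \<Rightarrow> bool" where
  "Ck_on 0 S f \<longleftrightarrow> continuous_on S f"
| "Ck_on (Suc k) S f \<longleftrightarrow>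
     (\<forall>x\<in>S. f differentiable (at x)) \<and> (\<forall>i. Ck_on k S (pderiv_at i f))"

definition hessian :: "(real^'n \<Rightarrow> real) \<Rightarrow> real^'n \<Rightarrow> real^'n^'n" where
  "hessian f x = (\<chi> i j. pderiv_at i (pderiv_at j f) x)"

definition laplacian :: "(real^'n \<Rightarrow> real) \<Rightarrow> real^'n \<Rightarrow> real" where
  "laplacian f x = (\<Sum>i\<in>UNIV. pderiv_at i (pderiv_at i f) x)"

definition test_function_on :: "(real^'n) set \<Rightarrow> (real^'n \<Rightarrow> real) \<Rightarrow> bool" where
  "test_function_on S \<phi> \<longleftrightarrow>
     (\<forall>k. Ck_on k UNIV \<phi>) \<and>
     compact (closure {x. \<phi> x \<noteq> 0}) \<and> closure {x. \<phi> x \<noteq> 0} \<subseteq> S"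

(* Nonnegativity of the distributional Laplacian; meaningful for f locally integrable on the
   open set S. The integral is restricted to S since f is arbitrary outside. *)
definition distr_laplacian_nonneg_on :: "(real^'n) set \<Rightarrow> (real^'n \<Rightarrow> real) \<Rightarrow> bool" where
  "distr_laplacian_nonneg_on S f \<longleftrightarrow>
     (\<forall>\<phi>. test_function_on S \<phi> \<and> (\<forall>x. 0 \<le> \<phi> x) \<longrightarrow>
        0 \<le> (LINT x:S|lebesgue. f x * laplacian \<phi> x))"

definition Linfty_on :: "(real^'n) set \<Rightarrow> (real^'n \<Rightarrow> real) \<Rightarrow> bool" where
  "Linfty_on S f \<longleftrightarrow>
     f \<in> borel_measurable (lebesgue_on S) \<and> (\<exists>K. AE x in lebesgue_on S. \<bar>f x\<bar> \<le> K)"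

definition C0loc_limit_on ::
  "(real^'n) set \<Rightarrow> (nat \<Rightarrow> real^'n \<Rightarrow> real) \<Rightarrow> (real^'n \<Rightarrow> real) \<Rightarrow> bool" where
  "C0loc_limit_on S g f \<longleftrightarrow>
     (\<forall>K. compact K \<and> K \<subseteq> S \<longrightarrow> uniform_limit K g f sequentially)"

end

theory Submission
  imports Defs
begin

text \<open>
The functions \<open>\<xi>s i\<close> satisfy \<open>D\<^sup>2 \<xi>s i \<in> closure U\<close> and \<open>U\<close> absorbs positive definite matrices. So if a
smooth function \<open>\<psi>\<close> has a Hessian outside \<open>U\<close>, the difference of \<open>\<xi>\<close> and \<open>\<psi>\<close> has no interior maximum that
is stable under small perturbations; this is the comparison principle \<open>comparison_principle\<close>. The
same lemma, applied to the half space of matrices with positive trace, expresses that \<open>\<xi>\<close> is subharmonic.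

Fix \<open>x \<noteq> 0\<close> near the origin. The hypothesis on \<open>\<eta>\<close> makes \<open>\<xi>(x) + a \<eta>(y - x)\<close>, for \<open>a > 0\<close>, an admissible
\<open>\<psi>\<close> on the ball of radius \<open>1/2\<close> around \<open>x\<close> without its centre. It agrees with \<open>\<xi>\<close> at the centre, and for
\<open>a = (sup \<xi> - inf \<xi>) / min \<eta>\<close>, the minimum being taken over the sphere of radius \<open>1/2\<close>, it dominates \<open>\<xi>\<close>
on the boundary sphere. If the comparison principle applied to this domain, it would give
\<open>\<xi>(y) - \<xi>(x) \<le> a \<eta>(y - x)\<close>, and exchanging \<open>x\<close> and \<open>y\<close> would finish the estimate, with a constant
that depends only on \<open>\<eta>\<close>.

The obstacle is that the domain contains the origin, where \<open>\<xi>\<close> is not known to be a subsolution. It is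
removed by \<open>comparison_across_point\<close>. A failure of the comparison would have to concentrate at the
origin. Since quadratic and linear perturbations of \<open>\<psi>\<close> are still admissible, \<open>\<xi>\<close> would then lie below a
translate of \<open>\<psi>\<close> by at least a multiple of \<open>|y|\<close> while reaching it at the origin, which contradicts the
maximum principle for bounded subharmonic functions on a punctured ball
(\<open>punctured_maximum_principle\<close>). That maximum principle, proved with a logarithmic barrier, is also
the first assertion of the theorem.

The estimate shows that \<open>\<xi>\<close> is uniformly continuous near the origin because \<open>\<eta>\<close> vanishes there, so \<open>\<xi>\<close> has a
continuous extension, which inherits the estimate.
\<close>

section \<open>Second derivatives at a point\<close>

text \<open>Sums, multiples and translates of functions are compared with each other at a single point below,
so a pointwise notion with closure rules is handier than iterated partial derivatives on a set.
The vector field \<open>g\<close> in the definition is the gradient.\<close>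
definition has_hessian :: "(real^'n \<Rightarrow> real) \<Rightarrow> real^'n^'n \<Rightarrow> real^'n \<Rightarrow> bool" where
  "has_hessian f H z \<longleftrightarrow>
     (\<exists>g. (\<forall>\<^sub>F y in nhds z. (f has_derivative (\<lambda>h. g y \<bullet> h)) (at y)) \<and>
          (g has_derivative (\<lambda>h. H *v h)) (at z))"

lemma has_hessianI:
  assumes "\<forall>\<^sub>F y in nhds z. (f has_derivative F y) (at y)"
    and "\<And>y h. F y h = g y \<bullet> h"
    and "(g has_derivative G) (at z)" and "\<And>h. G h = H *v h"
  shows "has_hessian f H z"
proof -
  have "F = (\<lambda>y h. g y \<bullet> h)" "G = (\<lambda>h. H *v h)" using assms(2,4) by auto
  then show ?thesis using assms(1,3) unfolding has_hessian_def by blast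
qed

lemma has_hessianE:
  assumes "has_hessian f H z"
  obtains g where "\<forall>\<^sub>F y in nhds z. (f has_derivative (\<lambda>h. g y \<bullet> h)) (at y)"
    and "(g has_derivative (\<lambda>h. H *v h)) (at z)"
  using assms unfolding has_hessian_def by blast

lemma has_hessian_isCont:
  assumes "has_hessian f H z"
  shows "isCont f z"
  using assms by (rule has_hessianE) (metis eventually_nhds_x_imp_x has_derivative_continuous)

lemma has_hessian_const: "has_hessian (\<lambda>y. c) 0 z"
  by (rule has_hessianI[where g = "\<lambda>y. 0"]) (auto intro!: always_eventually derivative_eq_intros)

lemma has_hessian_add:
  assumes "has_hessian f A z" "has_hessian g B z"
  shows "has_hessian (\<lambda>y. f y + g y) (A + B) z"
proof -
  obtain f' where f: "\<forall>\<^sub>F y in nhds z. (f has_derivative (\<lambda>h. f' y \<bullet> h)) (at y)"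
    "(f' has_derivative (\<lambda>h. A *v h)) (at z)" using has_hessianE[OF assms(1)] .
  obtain g' where g: "\<forall>\<^sub>F y in nhds z. (g has_derivative (\<lambda>h. g' y \<bullet> h)) (at y)"
    "(g' has_derivative (\<lambda>h. B *v h)) (at z)" using has_hessianE[OF assms(2)] .
  show ?thesis
  proof (rule has_hessianI)
    show "\<forall>\<^sub>F y in nhds z. ((\<lambda>y. f y + g y) has_derivative (\<lambda>h. f' y \<bullet> h + g' y \<bullet> h)) (at y)"
      using f(1) g(1) by eventually_elim (rule has_derivative_add)
    show "((\<lambda>y. f' y + g' y) has_derivative (\<lambda>h. A *v h + B *v h)) (at z)"
      by (rule has_derivative_add[OF f(2) g(2)])
  qed (auto simp: inner_add_left matrix_vector_mult_add_rdistrib)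
qed

lemma has_hessian_cmult:
  assumes "has_hessian f A z"
  shows "has_hessian (\<lambda>y. c * f y) (c *\<^sub>R A) z"
proof -
  obtain f' where f: "\<forall>\<^sub>F y in nhds z. (f has_derivative (\<lambda>h. f' y \<bullet> h)) (at y)"
    "(f' has_derivative (\<lambda>h. A *v h)) (at z)" using has_hessianE[OF assms] .
  show ?thesis
  proof (rule has_hessianI)
    show "\<forall>\<^sub>F y in nhds z. ((\<lambda>y. c * f y) has_derivative (\<lambda>h. c * (f' y \<bullet> h))) (at y)"
      using f(1) by eventually_elim (rule has_derivative_mult_right)
    show "((\<lambda>y. c *\<^sub>R f' y) has_derivative (\<lambda>h. c *\<^sub>R (A *v h))) (at z)"
      by (rule has_derivative_scaleR_right[OF f(2)])
  qed (auto simp: scaleR_matrix_vector_assoc)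
qed

lemma has_hessian_inner: "has_hessian (\<lambda>y. p \<bullet> y) 0 z"
  by (rule has_hessianI[where g = "\<lambda>y. p" and F = "\<lambda>y h. p \<bullet> h"])
     (auto intro!: always_eventually derivative_eq_intros)

lemma mat_matrix_vector_mult: "mat c *v h = c *\<^sub>R (h :: real^'n)"
  by (simp add: vec_eq_iff matrix_vector_mult_def mat_def if_distrib[of "\<lambda>a. a * _"] cong: if_cong)

lemma has_hessian_square: "has_hessian (\<lambda>y. y \<bullet> y) (mat 2) z"
  by (rule has_hessianI[where g = "\<lambda>y. 2 *\<^sub>R y" and F = "\<lambda>y h. 2 * (y \<bullet> h)"])
     (auto intro!: always_eventually derivative_eq_intros simp: inner_commute mat_matrix_vector_mult)

lemma has_hessian_shift:
  assumes "has_hessian f A (z - x)"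
  shows "has_hessian (\<lambda>y. f (y - x)) A z"
proof -
  obtain f' where f: "\<forall>\<^sub>F y in nhds (z - x). (f has_derivative (\<lambda>h. f' y \<bullet> h)) (at y)"
    "(f' has_derivative (\<lambda>h. A *v h)) (at (z - x))" using has_hessianE[OF assms] .
  have sh: "((\<lambda>y. y - x) has_derivative (\<lambda>h. h)) (at w)" for w
    by (auto intro!: derivative_eq_intros)
  show ?thesis
  proof (rule has_hessianI)
    have "filterlim (\<lambda>y. y - x) (nhds (z - x)) (nhds z)"
      by (intro tendsto_intros filterlim_ident)
    from eventually_compose_filterlim[OF f(1) this]
    show "\<forall>\<^sub>F y in nhds z. ((\<lambda>y. f (y - x)) has_derivative (\<lambda>h. f' (y - x) \<bullet> h)) (at y)"
      by eventually_elim (auto dest: has_derivative_compose[OF sh])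
    show "((\<lambda>y. f' (y - x)) has_derivative (\<lambda>h. A *v h)) (at z)"
      using has_derivative_compose[OF sh f(2)] by simp
  qed auto
qed

text \<open>The second difference is the increment in \<open>c\<close> of
\<open>c \<mapsto> f (z + c u + t v) - f (z + c u)\<close> over \<open>[0, t]\<close>. The mean value theorem turns it into \<open>t\<close> times a
difference of gradients at two points within distance \<open>t (|u| + |v|)\<close> of \<open>z\<close>, and the linearisation of
the gradient at \<open>z\<close> evaluates that. This one expansion gives both the symmetry of the Hessian and the
second order condition at a maximum.\<close>
lemma has_hessian_second_difference:
  assumes "has_hessian f H z" "e > 0"
  shows "\<forall>\<^sub>F t in at_right 0.
    \<bar>f (z + t *\<^sub>R u + t *\<^sub>R v) - f (z + t *\<^sub>R u) - f (z + t *\<^sub>R v) + f z - t\<^sup>2 * ((H *v v) \<bullet> u)\<bar>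
      \<le> t\<^sup>2 * (2 * e * (norm u + norm v)\<^sup>2)"
proof -
  obtain g where g: "\<forall>\<^sub>F y in nhds z. (f has_derivative (\<lambda>h. g y \<bullet> h)) (at y)"
    "(g has_derivative (\<lambda>h. H *v h)) (at z)" using assms(1) unfolding has_hessian_def by blast
  obtain d1 where d1: "d1 > 0" "\<And>y. dist y z < d1 \<Longrightarrow> (f has_derivative (\<lambda>h. g y \<bullet> h)) (at y)"
    using g(1) unfolding eventually_nhds_metric by blast
  obtain d2 where d2: "d2 > 0"
    "\<And>y. norm (y - z) < d2 \<Longrightarrow> norm (g y - g z - H *v (y - z)) \<le> e * norm (y - z)"
    using g(2) assms(2) unfolding has_derivative_at_alt by blast
  define s where "s = norm u + norm v"
  define d where "d = min d1 d2"
  have d: "d > 0" using d1 d2 by (simp add: d_def)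
  have s: "s \<ge> 0" by (simp add: s_def)
  have "\<forall>\<^sub>F t in at_right (0::real). t * s < d"
  proof (rule order_tendstoD)
    show "((\<lambda>t. t * s) \<longlongrightarrow> 0) (at_right (0::real))" by (auto intro!: tendsto_eq_intros)
  qed (rule d)
  moreover have "\<forall>\<^sub>F t in at_right (0::real). 0 < t" by (rule eventually_at_right_less)
  ultimately show ?thesis
  proof eventually_elim
    case (elim t)
    have small: "norm (c *\<^sub>R u + b *\<^sub>R v) \<le> t * s" if "0 \<le> c" "c \<le> t" "0 \<le> b" "b \<le> t" for b c
    proof -
      have "norm (c *\<^sub>R u + b *\<^sub>R v) \<le> c * norm u + b * norm v"
        using norm_triangle_ineq[of "c *\<^sub>R u" "b *\<^sub>R v"] that by simp
      also have "\<dots> \<le> t * norm u + t * norm v" using that by (intro add_mono mult_right_mono) auto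
      finally show ?thesis by (simp add: s_def algebra_simps)
    qed
    \<comment> \<open>The terms with factor \<open>0\<close> put both summands of \<open>F\<close> in the form that \<open>der\<close> and \<open>R\<close> treat.\<close>
    define F where "F c = f (z + (c *\<^sub>R u + t *\<^sub>R v)) - f (z + (c *\<^sub>R u + 0 *\<^sub>R v))" for c
    have der: "((\<lambda>c. f (z + (c *\<^sub>R u + b *\<^sub>R v))) has_real_derivative
        g (z + (c *\<^sub>R u + b *\<^sub>R v)) \<bullet> u) (at c)" if "0 \<le> c" "c \<le> t" "0 \<le> b" "b \<le> t" for b c
    proof -
      have "((\<lambda>c. z + (c *\<^sub>R u + b *\<^sub>R v)) has_derivative (\<lambda>h. h *\<^sub>R u)) (at c)"
        by (auto intro!: derivative_eq_intros)
      moreover have "(f has_derivative (\<lambda>h. g (z + (c *\<^sub>R u + b *\<^sub>R v)) \<bullet> h)) (at (z + (c *\<^sub>R u + b *\<^sub>R v)))"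
        using small[OF that] elim by (intro d1) (auto simp: dist_norm d_def)
      ultimately have "((\<lambda>c. f (z + (c *\<^sub>R u + b *\<^sub>R v))) has_derivative
         (\<lambda>h. g (z + (c *\<^sub>R u + b *\<^sub>R v)) \<bullet> (h *\<^sub>R u))) (at c)"
        by (rule has_derivative_compose)
      then show ?thesis by (simp add: has_field_derivative_def mult.commute[of _ "_ \<bullet> u"])
    qed
    obtain c where c: "0 < c" "c < t"
      "F t - F 0 = (t - 0) * (g (z + (c *\<^sub>R u + t *\<^sub>R v)) \<bullet> u - g (z + (c *\<^sub>R u + 0 *\<^sub>R v)) \<bullet> u)"
    proof (rule exE[OF MVT2[of 0 t F "\<lambda>c. g (z + (c *\<^sub>R u + t *\<^sub>R v)) \<bullet> u - g (z + (c *\<^sub>R u + 0 *\<^sub>R v)) \<bullet> u"]])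
      show "0 < t" by fact
      show "(F has_real_derivative g (z + (c *\<^sub>R u + t *\<^sub>R v)) \<bullet> u - g (z + (c *\<^sub>R u + 0 *\<^sub>R v)) \<bullet> u) (at c)"
        if "0 \<le> c" "c \<le> t" for c
        unfolding F_def using that elim by (intro DERIV_diff der) auto
    qed auto
    define R where "R w = g (z + w) - g z - H *v w" for w
    have R: "\<bar>R (c *\<^sub>R u + b *\<^sub>R v) \<bullet> u\<bar> \<le> e * (t * s) * s" if "0 \<le> b" "b \<le> t" for b
    proof -
      have n: "norm (c *\<^sub>R u + b *\<^sub>R v) \<le> t * s" using small[of c b] c that by auto
      have "norm (R (c *\<^sub>R u + b *\<^sub>R v)) \<le> e * norm (c *\<^sub>R u + b *\<^sub>R v)"
        using d2(2)[of "z + (c *\<^sub>R u + b *\<^sub>R v)"] n elim by (auto simp: R_def d_def)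
      also have "\<dots> \<le> e * (t * s)" using n assms(2) by simp
      finally have "norm (R (c *\<^sub>R u + b *\<^sub>R v)) * norm u \<le> e * (t * s) * s"
        using assms(2) elim s by (intro mult_mono) (auto simp: s_def)
      then show ?thesis using Cauchy_Schwarz_ineq2[of "R (c *\<^sub>R u + b *\<^sub>R v)" u] by linarith
    qed
    have "g (z + (c *\<^sub>R u + t *\<^sub>R v)) \<bullet> u - g (z + (c *\<^sub>R u + 0 *\<^sub>R v)) \<bullet> u
        = t * ((H *v v) \<bullet> u) + R (c *\<^sub>R u + t *\<^sub>R v) \<bullet> u - R (c *\<^sub>R u + 0 *\<^sub>R v) \<bullet> u"
      by (simp add: R_def inner_diff_left inner_add_left matrix_vector_right_distrib
        matrix_vector_mult_scaleR)
    then have "F t - F 0 - t\<^sup>2 * ((H *v v) \<bullet> u)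
        = t * (R (c *\<^sub>R u + t *\<^sub>R v) \<bullet> u - R (c *\<^sub>R u + 0 *\<^sub>R v) \<bullet> u)"
      unfolding c(3) power2_eq_square by (simp only:) (simp add: algebra_simps)
    also have "\<bar>\<dots>\<bar> \<le> t * (2 * (e * (t * s) * s))"
      unfolding abs_mult using R[of t] R[of 0] elim by (intro mult_mono) auto
    finally show ?case
      by (simp add: F_def s_def power2_eq_square algebra_simps)
  qed
qed

text \<open>The second difference does not change when \<open>u\<close> and \<open>v\<close> are exchanged, but its leading term is
\<open>t\<^sup>2 (H v \<bullet> u)\<close> in one order and \<open>t\<^sup>2 (H u \<bullet> v)\<close> in the other.\<close>
lemma has_hessian_symmetric:
  assumes "has_hessian f H z"
  shows "H \<in> sym_matrices"
proof -
  have eq: "(H *v v) \<bullet> u = (H *v u) \<bullet> v" for u v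
  proof -
    define s where "s = 4 * (norm u + norm v)\<^sup>2"
    have bound: "\<bar>(H *v v) \<bullet> u - (H *v u) \<bullet> v\<bar> \<le> e * s" if e: "e > 0" for e
    proof -
      have "\<forall>\<^sub>F t in at_right (0::real). \<bar>(H *v v) \<bullet> u - (H *v u) \<bullet> v\<bar> \<le> e * s"
        using has_hessian_second_difference[OF assms e, of u v]
          has_hessian_second_difference[OF assms e, of v u] eventually_at_right_less[of 0]
      proof eventually_elim
        case (elim t)
        have "\<bar>t\<^sup>2 * ((H *v v) \<bullet> u) - t\<^sup>2 * ((H *v u) \<bullet> v)\<bar> \<le> t\<^sup>2 * (2 * e * (norm u + norm v)\<^sup>2) * 2"
          using elim(1,2) by (simp add: add_ac)
        then have "t\<^sup>2 * \<bar>(H *v v) \<bullet> u - (H *v u) \<bullet> v\<bar> \<le> t\<^sup>2 * (e * s)"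
          by (simp add: s_def abs_mult flip: right_diff_distrib)
        then show ?case using elim(3) by simp
      qed
      then show ?thesis by (simp add: eventually_const)
    qed
    have "\<bar>(H *v v) \<bullet> u - (H *v u) \<bullet> v\<bar> \<le> d" if "d > 0" for d
    proof -
      have "s \<ge> 0" by (simp add: s_def)
      then have "\<bar>(H *v v) \<bullet> u - (H *v u) \<bullet> v\<bar> \<le> d / (s + 1) * s"
        using bound[of "d / (s + 1)"] that by simp
      also have "\<dots> \<le> d" using \<open>s \<ge> 0\<close> that by (simp add: field_simps)
      finally show ?thesis .
    qed
    then show ?thesis using dense_ge[of 0 "\<bar>(H *v v) \<bullet> u - (H *v u) \<bullet> v\<bar>"] by simp
  qed
  have "H $ i $ j = H $ j $ i" for i j
    using eq[of "axis j 1" "axis i 1"]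
    by (simp add: matrix_vector_mul_component inner_axis inner_axis' inner_commute)
  then show ?thesis by (simp add: sym_matrices_def transpose_def vec_eq_iff)
qed

lemma matrix_vector_mult_minus: "A *v (- v) = - (A *v (v :: real^'n))" for A :: "real^'n^'m"
  using matrix_vector_mult_scaleR[of A "-1" v] by simp

text \<open>The second difference with \<open>u = v\<close> and with \<open>-v\<close> in place of \<open>v\<close> is
\<open>2 f(z) - f(z + t v) - f(z - t v)\<close>, which is nonnegative at a maximum, while its leading term is
\<open>- t\<^sup>2 (v \<bullet> H v)\<close>.\<close>
lemma has_hessian_local_max:
  assumes "has_hessian f H z" and max: "\<forall>\<^sub>F y in nhds z. f y \<le> f z"
  shows "v \<bullet> (H *v v) \<le> 0"
proof (rule ccontr)
  assume pos: "\<not> v \<bullet> (H *v v) \<le> 0"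
  define q where "q = v \<bullet> (H *v v)"
  have q: "q > 0" using pos by (simp add: q_def)
  then have v: "(norm v)\<^sup>2 > 0" by (auto simp: q_def)
  \<comment> \<open>Here \<open>|u| + |v| = 2 |v|\<close>, so the error term is \<open>8 e |v|\<^sup>2 t\<^sup>2 = q t\<^sup>2 / 2\<close>, half of the leading term.\<close>
  define e where "e = q / (16 * (norm v)\<^sup>2)"
  have e: "e > 0" using q v by (simp add: e_def)
  have "\<forall>\<^sub>F t in at_right (0::real). f (z + t *\<^sub>R w) \<le> f z" for w
  proof (rule eventually_compose_filterlim[OF max])
    show "filterlim (\<lambda>t. z + t *\<^sub>R w) (nhds z) (at_right (0::real))"
      by (auto intro!: tendsto_eq_intros)
  qed
  from has_hessian_second_difference[OF assms(1) e, of v "-v"] this[of v] this[of "-v"]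
    eventually_at_right_less[of 0]
  have "\<forall>\<^sub>F t in at_right (0::real). False"
  proof eventually_elim
    case (elim t)
    have "t\<^sup>2 * q \<le> t\<^sup>2 * (8 * e * (norm v)\<^sup>2)"
      using elim(1-3) by (simp add: q_def matrix_vector_mult_minus inner_commute power_mult_distrib)
    also have "\<dots> = t\<^sup>2 * (q / 2)" using v by (simp add: e_def)
    finally show False using q elim(4) by simp
  qed
  then show False by (simp add: eventually_const)
qed

lemma has_derivative_pderiv_at:
  assumes "f differentiable (at y)"
  shows "(f has_derivative (\<lambda>h. (\<chi> i. pderiv_at i f y) \<bullet> h)) (at y)"
proof -
  let ?D = "frechet_derivative f (at y)"
  have lin: "linear ?D" using assms by (rule linear_frechet_derivative)
  have "?D = (\<lambda>h. (\<chi> i. pderiv_at i f y) \<bullet> h)"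
  proof (rule ext)
    fix h
    have "?D h = ?D (\<Sum>i\<in>UNIV. (h $ i) *\<^sub>R axis i 1)"
      by (simp add: basis_expansion flip: scalar_mult_eq_scaleR)
    also have "\<dots> = (\<Sum>i\<in>UNIV. h $ i * pderiv_at i f y)"
      by (simp add: linear_sum[OF lin] linear_cmul[OF lin] pderiv_at_def)
    finally show "?D h = (\<chi> i. pderiv_at i f y) \<bullet> h" by (simp add: inner_vec_def mult.commute)
  qed
  then show ?thesis using assms unfolding frechet_derivative_works by simp
qed

text \<open>Differentiating the gradient puts the outer derivative in the column index, which produces the transpose
of \<open>hessian f z\<close>. The symmetry of second derivatives then identifies the two.\<close>
lemma Ck_on_2_has_hessian:
  assumes "open S" "Ck_on 2 S f" "z \<in> S"
  shows "has_hessian f (hessian f z) z"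
proof -
  have d1: "f differentiable (at y)" if "y \<in> S" for y
    using assms(2) that by (simp add: numeral_2_eq_2)
  have d2: "pderiv_at i f differentiable (at z)" for i
    using assms(2,3) by (simp add: numeral_2_eq_2)
  have "has_hessian f (transpose (hessian f z)) z"
  proof (rule has_hessianI)
    have "\<forall>\<^sub>F y in nhds z. y \<in> S" using assms by (simp add: eventually_nhds_in_open)
    then show "\<forall>\<^sub>F y in nhds z. (f has_derivative (\<lambda>h. (\<chi> i. pderiv_at i f y) \<bullet> h)) (at y)"
      by eventually_elim (intro has_derivative_pderiv_at d1)
    show "((\<lambda>y. \<chi> i. pderiv_at i f y) has_derivative
        (\<lambda>h. \<chi> i. (\<chi> j. pderiv_at j (pderiv_at i f) z) \<bullet> h)) (at z)"
      by (subst has_derivative_componentwise_within)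
         (auto simp: Basis_vec_def inner_axis intro: has_derivative_pderiv_at d2)
  qed (auto simp: vec_eq_iff matrix_vector_mul_component transpose_def hessian_def)
  moreover from has_hessian_symmetric[OF this] have "transpose (hessian f z) = hessian f z"
    by (simp add: sym_matrices_def)
  ultimately show ?thesis by simp
qed

lemma laplacian_eq_trace_hessian: "laplacian f z = trace (hessian f z)"
  by (simp add: laplacian_def trace_def hessian_def)

text \<open>In dimension at least two the function \<open>- ln |y|\<^sup>2\<close> is superharmonic, and it tends to infinity at the
origin. It is the barrier that makes an isolated point invisible to bounded subharmonic functions.\<close>
lemma has_hessian_neg_ln_square:
  fixes z :: "real^'n"
  assumes "z \<noteq> 0" "CARD('n) \<ge> 2"
  shows "\<exists>H. has_hessian (\<lambda>y. - ln (y \<bullet> y)) H z \<and> trace H \<le> 0"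
proof -
  define q where "q = z \<bullet> z"
  have q: "q > 0" using assms(1) by (simp add: q_def)
  define H :: "real^'n^'n" where
    "H = (\<chi> i j. (if i = j then - (2 / q) else 0) + 4 / q\<^sup>2 * (z $ i * z $ j))"
  have H: "H *v h = - (2 / q) *\<^sub>R h + (4 / q\<^sup>2 * (z \<bullet> h)) *\<^sub>R z" for h
  proof -
    have "(H *v h) $ i = (\<Sum>j\<in>UNIV. (if i = j then - (2 / q) * h $ j else 0) + 4 / q\<^sup>2 * z $ i * (z $ j * h $ j))" for i
      by (auto simp: H_def matrix_vector_mult_def distrib_right intro!: sum.cong)
    also have "\<dots> i = - (2 / q) * h $ i + 4 / q\<^sup>2 * z $ i * (z \<bullet> h)" for i
      by (simp add: sum.distrib inner_vec_def sum_distrib_left sum_divide_distrib)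
    finally show ?thesis by (simp add: vec_eq_iff)
  qed
  have "has_hessian (\<lambda>y. - ln (y \<bullet> y)) H z"
  proof (rule has_hessianI)
    have "\<forall>\<^sub>F y in nhds z. y \<in> - {0}"
      using assms by (intro eventually_nhds_in_open) auto
    then show "\<forall>\<^sub>F y in nhds z. ((\<lambda>y. - ln (y \<bullet> y)) has_derivative (\<lambda>h. - (2 * (y \<bullet> h) / (y \<bullet> y)))) (at y)"
      by eventually_elim (auto intro!: derivative_eq_intros simp: inner_commute divide_simps)
    show "((\<lambda>y. - (2 / (y \<bullet> y)) *\<^sub>R y) has_derivative
       (\<lambda>h. - (2 / q) *\<^sub>R h + (4 / q\<^sup>2 * (z \<bullet> h)) *\<^sub>R z)) (at z)"
    proof -
      have "((\<lambda>y. - (2 / (y \<bullet> y))) has_derivative (\<lambda>h. 4 / q\<^sup>2 * (z \<bullet> h))) (at z)"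
        using assms(1) by (auto intro!: derivative_eq_intros
          simp: inner_commute power2_eq_square q_def divide_simps)
      from has_derivative_scaleR[OF this has_derivative_ident] show ?thesis by (simp add: q_def)
    qed
  qed (auto simp: H)
  moreover have "trace H \<le> 0"
  proof -
    have zz: "(\<Sum>i\<in>UNIV. z $ i * z $ i) = q" by (simp add: q_def inner_vec_def)
    have "trace H = - (2 / q) * CARD('n) + 4 / q\<^sup>2 * q"
      by (simp add: trace_def H_def sum_subtractf zz flip: sum_distrib_left sum_divide_distrib)
    also have "\<dots> = (4 - 2 * real CARD('n)) / q" using q by (simp add: field_simps power2_eq_square)
    also have "\<dots> \<le> 0" using assms(2) q by (simp add: divide_nonpos_pos)
    finally show ?thesis .
  qed
  ultimately show ?thesis by blast
qed

section \<open>Comparison of weak subsolutions with smooth functions\<close>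

text \<open>The minimum of the quadratic form over the unit sphere is attained, hence positive.\<close>
lemma posdef_coercive:
  assumes "N \<in> posdef_matrices"
  obtains c where "c > 0" "\<And>v :: real^'n. c * (v \<bullet> v) \<le> v \<bullet> (N *v v)"
proof -
  have "continuous_on (sphere 0 1) (\<lambda>v :: real^'n. v \<bullet> (N *v v))"
    by (intro continuous_intros)
  from continuous_attains_inf[OF compact_sphere _ this] obtain w :: "real^'n" where w: "w \<in> sphere 0 1"
    "\<And>v :: real^'n. v \<in> sphere 0 1 \<Longrightarrow> w \<bullet> (N *v w) \<le> v \<bullet> (N *v v)"
    by auto
  show ?thesis
  proof
    have "w \<noteq> 0" using w(1) by auto
    then show "w \<bullet> (N *v w) > 0" using assms by (simp add: posdef_matrices_def)
    show "(w \<bullet> (N *v w)) * (v \<bullet> v) \<le> v \<bullet> (N *v v)" for v :: "real^'n"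
    proof (cases "v = 0")
      case False
      have "w \<bullet> (N *v w) \<le> ((1 / norm v) *\<^sub>R v) \<bullet> (N *v ((1 / norm v) *\<^sub>R v))"
        using False by (intro w(2)) auto
      also have "\<dots> = (v \<bullet> (N *v v)) / (v \<bullet> v)"
        by (simp add: matrix_vector_mult_scaleR dot_square_norm power2_eq_square)
      finally show ?thesis using False by (simp add: field_simps)
    qed auto
  qed
qed

text \<open>If \<open>X\<close> is an element of \<open>U\<close> close to \<open>M\<close>, then \<open>M + N = X + (N + (M - X))\<close>, and \<open>N + (M - X)\<close> is still
positive definite because \<open>N\<close> is uniformly so.\<close>
lemma elliptic_cone_closure_add_posdef:
  assumes "elliptic_cone U" "M \<in> closure U" "N \<in> posdef_matrices"
  shows "M + N \<in> (U :: (real^'n^'n) set)"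
proof -
  have U: "U \<subseteq> sym_matrices" "\<And>M N. M \<in> U \<Longrightarrow> N \<in> posdef_matrices \<Longrightarrow> M + N \<in> U"
    using assms(1) by (auto simp: elliptic_cone_def openin_subtopology)
  obtain c where c: "c > 0" "\<And>v :: real^'n. c * (v \<bullet> v) \<le> v \<bullet> (N *v v)"
    using posdef_coercive[OF assms(3)] by blast
  obtain X where X: "\<And>n. X n \<in> U" "X \<longlonglongrightarrow> M"
    using assms(2) by (auto simp: closure_sequential)
  have onormX: "(\<lambda>n. onorm ((*v) (M - X n))) \<longlonglongrightarrow> 0"
  proof -
    have "(\<lambda>n. \<Sum>i\<in>UNIV. \<Sum>j\<in>UNIV. \<bar>(M - X n) $ i $ j\<bar>) \<longlonglongrightarrow> (\<Sum>i\<in>UNIV. \<Sum>j\<in>UNIV. \<bar>(M - M) $ i $ j\<bar>)"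
      by (intro tendsto_intros X(2))
    then have lim: "(\<lambda>n. \<Sum>i\<in>UNIV. \<Sum>j\<in>UNIV. \<bar>(M - X n) $ i $ j\<bar>) \<longlonglongrightarrow> 0" by simp
    show ?thesis
    proof (rule tendsto_sandwich[OF _ _ tendsto_const lim])
      show "\<forall>\<^sub>F n in sequentially. 0 \<le> onorm ((*v) (M - X n))"
        by (intro always_eventually allI onorm_pos_le matrix_vector_mul_bounded_linear)
      show "\<forall>\<^sub>F n in sequentially. onorm ((*v) (M - X n)) \<le> (\<Sum>i\<in>UNIV. \<Sum>j\<in>UNIV. \<bar>(M - X n) $ i $ j\<bar>)"
        by (intro always_eventually allI onorm_le_matrix_component_sum)
    qed
  qed
  have symc: "closed (sym_matrices :: (real^'n^'n) set)"
  proof -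
    have eq: "sym_matrices = (\<Inter>i. \<Inter>j. {M :: real^'n^'n. M $ i $ j = M $ j $ i})"
      by (auto simp: sym_matrices_def transpose_def vec_eq_iff)
    show ?thesis unfolding eq by (intro closed_INT ballI closed_Collect_eq continuous_intros)
  qed
  have Ms: "M \<in> sym_matrices" using assms(2) U(1) closure_minimal[OF U(1) symc] by auto
  obtain n where n: "onorm ((*v) (M - X n)) < c"
    using order_tendstoD(2)[OF onormX c(1)] by (auto simp: eventually_sequentially)
  have "N + (M - X n) \<in> posdef_matrices"
  proof -
    have "v \<bullet> ((N + (M - X n)) *v v) > 0" if "v \<noteq> 0" for v
    proof -
      have "\<bar>v \<bullet> ((M - X n) *v v)\<bar> \<le> norm v * norm ((M - X n) *v v)"
        by (rule Cauchy_Schwarz_ineq2)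
      also have "\<dots> \<le> norm v * (onorm ((*v) (M - X n)) * norm v)"
        by (intro mult_left_mono onorm matrix_vector_mul_bounded_linear) auto
      also have "\<dots> < norm v * (c * norm v)" using n that by simp
      also have "\<dots> = c * (v \<bullet> v)" by (simp add: dot_square_norm power2_eq_square)
      also have "\<dots> \<le> v \<bullet> (N *v v)" by (rule c)
      finally show ?thesis by (simp add: matrix_vector_mult_add_rdistrib inner_add_right)
    qed
    moreover have "N + (M - X n) \<in> sym_matrices"
      using Ms X(1)[of n] U(1) assms(3)
      by (auto simp: sym_matrices_def posdef_matrices_def transpose_def vec_eq_iff subset_eq)
    ultimately show ?thesis by (simp add: posdef_matrices_def)
  qed
  from U(2)[OF X(1)[of n] this] show ?thesis by (simp add: algebra_simps)
qed

text \<open>The condition on the Hessians of the approximants says no more than what a touching argument consumes.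
For an elliptic cone \<open>U\<close> it holds whenever they lie in the closure of \<open>U\<close>. For the half space of
matrices of positive trace it holds whenever the approximants are subharmonic, so that subharmonic
functions and subsolutions with respect to \<open>U\<close> are covered by the same lemmas.\<close>
definition weak_subsolution_on ::
  "(real^'n^'n) set \<Rightarrow> (real^'n) set \<Rightarrow> (real^'n \<Rightarrow> real) \<Rightarrow> bool" where
  "weak_subsolution_on U S \<xi> \<longleftrightarrow>
     (\<exists>\<xi>s. C0loc_limit_on S \<xi>s \<xi> \<and>
       (\<forall>i. \<forall>z\<in>S. \<exists>H. has_hessian (\<xi>s i) H z \<and> (\<forall>N\<in>posdef_matrices. H + N \<in> U)))"

text \<open>If \<open>\<xi> - \<psi>\<close> were positive somewhere, then so would be, by a margin, \<open>\<xi>s i - \<psi>\<close> for large \<open>i\<close>, and adding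
a small multiple \<open>\<delta> |x|\<^sup>2\<close> keeps the maximum over \<open>K\<close> inside \<open>D\<close>. At that maximum the Hessian of \<open>\<psi>\<close>
exceeds the one of \<open>\<xi>s i\<close> by a positive definite matrix, so it belongs to \<open>U\<close>.
The sets \<open>K\<close> and \<open>D\<close> stand for a closed domain and its interior; asking for the boundary inequality on
all of \<open>K - D\<close> avoids computing frontiers.\<close>
lemma comparison_principle:
  fixes \<xi> \<psi> :: "real^'n \<Rightarrow> real"
  assumes \<xi>: "weak_subsolution_on U S \<xi>"
    and K: "compact K" "K \<subseteq> S" and D: "open D" "D \<subseteq> K"
    and cont: "continuous_on K \<psi>"
    and super: "\<And>z. z \<in> D \<Longrightarrow> \<exists>H. has_hessian \<psi> H z \<and> H \<notin> U"
    and bd: "\<And>y. y \<in> K - D \<Longrightarrow> \<xi> y \<le> \<psi> y"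
    and y: "y \<in> K"
  shows "\<xi> y \<le> \<psi> y"
proof (rule ccontr)
  assume neg: "\<not> \<xi> y \<le> \<psi> y"
  obtain \<xi>s where \<xi>s: "C0loc_limit_on S \<xi>s \<xi>"
    "\<And>i z. z \<in> S \<Longrightarrow> \<exists>H. has_hessian (\<xi>s i) H z \<and> (\<forall>N\<in>posdef_matrices. H + N \<in> U)"
    using \<xi> unfolding weak_subsolution_on_def by blast
  define t where "t = (\<xi> y - \<psi> y) / 4"
  have t: "t > 0" using neg by (simp add: t_def)
  obtain R where R: "R > 0" "\<And>x. x \<in> K \<Longrightarrow> norm x \<le> R"
    using compact_imp_bounded[OF K(1)] unfolding bounded_pos by blast
  define \<delta> where "\<delta> = t / R\<^sup>2"
  have \<delta>: "\<delta> > 0" using t R by (simp add: \<delta>_def)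
  have quad: "\<delta> * (x \<bullet> x) \<le> t" "\<delta> * (x \<bullet> x) \<ge> 0" if "x \<in> K" for x
  proof -
    have "x \<bullet> x \<le> R\<^sup>2" using R(2)[OF that] by (simp add: dot_square_norm power_mono)
    then show "\<delta> * (x \<bullet> x) \<le> t" using t R by (simp add: \<delta>_def field_simps)
  qed (use \<delta> in auto)
  have "uniform_limit K \<xi>s \<xi> sequentially" using \<xi>s(1) K by (simp add: C0loc_limit_on_def)
  from uniform_limitD[OF this t] obtain i where "\<forall>x\<in>K. dist (\<xi>s i x) (\<xi> x) < t"
    by (auto simp: eventually_sequentially)
  then have i: "\<bar>\<xi>s i x - \<xi> x\<bar> < t" if "x \<in> K" for x using that by (auto simp: dist_real_def)
  define w where "w x = \<xi>s i x + \<delta> * (x \<bullet> x) + (-1) * \<psi> x" for x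
  have "continuous_on K (\<xi>s i)"
    using \<xi>s(2)[of _ i] K(2) has_hessian_isCont by (blast intro: continuous_at_imp_continuous_on)
  then have "continuous_on K w" unfolding w_def by (intro continuous_intros cont)
  then obtain z where z: "z \<in> K" "\<And>x. x \<in> K \<Longrightarrow> w x \<le> w z"
    using continuous_attains_sup[OF K(1)] y by blast
  have "z \<in> D"
  proof (rule ccontr)
    assume "z \<notin> D"
    then have "w z < 2 * t" using bd[of z] z(1) quad[of z] i[of z] by (auto simp: w_def)
    moreover have "w y \<ge> 3 * t"
    proof -
      have "\<xi> y - \<psi> y = 4 * t" by (simp add: t_def)
      then show ?thesis using quad[of y] i[of y] y by (simp add: w_def)
    qed
    ultimately show False using z(2)[OF y] t by simp
  qed
  obtain A where A: "has_hessian (\<xi>s i) A z" "\<And>N. N \<in> posdef_matrices \<Longrightarrow> A + N \<in> U"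
    using \<xi>s(2)[of z i] z(1) K(2) by blast
  obtain B where B: "has_hessian \<psi> B z" "B \<notin> U" using super[OF \<open>z \<in> D\<close>] by blast
  have "has_hessian w (A + \<delta> *\<^sub>R mat 2 + (-1) *\<^sub>R B) z"
    unfolding w_def by (intro has_hessian_add has_hessian_cmult has_hessian_square A B)
  moreover have "\<forall>\<^sub>F x in nhds z. w x \<le> w z"
    using eventually_nhds_in_open[OF D(1) \<open>z \<in> D\<close>] by eventually_elim (use z(2) D(2) in auto)
  ultimately have le: "v \<bullet> ((A + \<delta> *\<^sub>R mat 2 + (-1) *\<^sub>R B) *v v) \<le> 0" for v
    by (rule has_hessian_local_max)
  have "v \<bullet> ((B - A) *v v) > 0" if "v \<noteq> 0" for v
  proof -
    have "0 < 2 * \<delta> * (v \<bullet> v)" using that \<delta> by simp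
    then show ?thesis using le[of v]
      by (simp add: matrix_vector_mult_add_rdistrib matrix_vector_mult_diff_rdistrib inner_add_right inner_diff_right
         mat_matrix_vector_mult flip: scaleR_matrix_vector_assoc)
  qed
  moreover have "B - A \<in> sym_matrices"
    using has_hessian_symmetric[OF A(1)] has_hessian_symmetric[OF B(1)]
    by (simp add: sym_matrices_def transpose_def vec_eq_iff)
  ultimately have "A + (B - A) \<in> U" by (intro A) (simp add: posdef_matrices_def)
  then show False using B(2) by simp
qed

lemma weak_subsolution_on_subset:
  "weak_subsolution_on U S \<xi> \<Longrightarrow> T \<subseteq> S \<Longrightarrow> weak_subsolution_on U T \<xi>"
  unfolding weak_subsolution_on_def C0loc_limit_on_def by (meson subset_iff order_trans)

lemma le_of_eventually_le_add_mult:
  fixes a b c :: real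
  assumes "\<forall>\<^sub>F e in at_right 0. a \<le> b + e * c"
  shows "a \<le> b"
proof (rule tendsto_lowerbound[OF _ assms])
  show "((\<lambda>e. b + e * c) \<longlongrightarrow> b) (at_right 0)"
    by (auto intro!: tendsto_eq_intros)
qed simp

section \<open>Comparison across an isolated singularity\<close>

text \<open>Compare \<open>\<xi>\<close> on the annulus between the radii \<open>s\<close> and \<open>r\<close> with
\<open>m + p \<bullet> w - \<epsilon> ln |w|\<^sup>2\<close>. The barrier is nonnegative because \<open>r \<le> 1\<close>, and for small \<open>s\<close> it exceeds the
upper bound \<open>B\<close> on the inner sphere. Then let \<open>\<epsilon>\<close> tend to \<open>0\<close>.\<close>
lemma punctured_maximum_principle:
  fixes \<xi> :: "real^'n \<Rightarrow> real"
  assumes n: "CARD('n) \<ge> 2"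
    and \<xi>: "weak_subsolution_on {M. trace M > 0} (cball 0 r - {0}) \<xi>"
    and r: "r \<le> 1"
    and B: "\<And>w. w \<in> cball 0 r - {0} \<Longrightarrow> \<xi> w \<le> B"
    and bd: "\<And>w. norm w = r \<Longrightarrow> \<xi> w \<le> m + p \<bullet> w"
    and y: "y \<in> cball 0 r - {0}"
  shows "\<xi> y \<le> m + p \<bullet> y"
proof (rule le_of_eventually_le_add_mult)
  show "\<forall>\<^sub>F \<epsilon> in at_right 0. \<xi> y \<le> m + p \<bullet> y + \<epsilon> * (- ln (y \<bullet> y))"
    using eventually_at_right_less[of 0]
  proof eventually_elim
    case (elim \<epsilon>)
    \<comment> \<open>With \<open>ln s\<close> below \<open>(m - 1 - B) / (2 \<epsilon>)\<close>, \<open>m - \<epsilon> ln s\<^sup>2\<close> exceeds \<open>B + 1\<close> on the inner sphere, and the linear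
       term costs less than \<open>1\<close>.\<close>
    have "((\<lambda>s. norm p * s) \<longlongrightarrow> 0) (at_right 0)" by (auto intro!: tendsto_eq_intros)
    then have "\<forall>\<^sub>F s in at_right 0. norm p * s < 1" by (rule order_tendstoD) simp
    moreover have "\<forall>\<^sub>F s in at_right 0. ln s < (m - 1 - B) / (2 * \<epsilon>)"
      using ln_at_0 by (simp add: filterlim_at_bot_dense)
    moreover have "\<forall>\<^sub>F s in at_right 0. s < norm y"
      using y by (intro order_tendstoD(2)[OF tendsto_ident_at]) simp
    ultimately have "\<forall>\<^sub>F s in at_right 0. 0 < s \<and> s < norm y \<and> norm p * s < 1 \<and> ln s < (m - 1 - B) / (2 * \<epsilon>)"
      using eventually_at_right_less[of 0] by eventually_elim auto
    from eventually_happens'[OF trivial_limit_at_right_real this] obtain s where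
      s: "0 < s" "s < norm y" "norm p * s < 1" "ln s < (m - 1 - B) / (2 * \<epsilon>)"
      by blast
    define \<psi> where "\<psi> w = m + (p \<bullet> w + \<epsilon> * (- ln (w \<bullet> w)))" for w
    have "\<xi> y \<le> \<psi> y"
    proof (rule comparison_principle[OF \<xi>])
      show "compact (cball 0 r - ball 0 s :: (real^'n) set)" by (intro compact_diff) auto
      show "open (ball 0 r - cball 0 s :: (real^'n) set)" by (intro open_Diff) auto
      show "continuous_on (cball 0 r - ball 0 s) \<psi>"
        unfolding \<psi>_def using s(1) by (intro continuous_intros) auto
      show "\<exists>H. has_hessian \<psi> H z \<and> H \<notin> {M. trace M > 0}" if "z \<in> ball 0 r - cball 0 s" for z
      proof -
        have "z \<noteq> 0" using that s(1) by auto
        from has_hessian_neg_ln_square[OF this n] obtain H where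
          H: "has_hessian (\<lambda>y. - ln (y \<bullet> y)) H z" "trace H \<le> 0" by blast
        have "has_hessian \<psi> (0 + (0 + \<epsilon> *\<^sub>R H)) z"
          unfolding \<psi>_def
          by (intro has_hessian_add has_hessian_cmult has_hessian_const has_hessian_inner H)
        moreover have "trace (\<epsilon> *\<^sub>R H) = \<epsilon> * trace H" by (simp add: trace_def sum_distrib_left)
        then have "trace (\<epsilon> *\<^sub>R H) \<le> 0" using elim H(2) by (simp add: mult_nonneg_nonpos)
        ultimately show ?thesis by auto
      qed
      show "\<xi> w \<le> \<psi> w" if "w \<in> (cball 0 r - ball 0 s) - (ball 0 r - cball 0 s)" for w
      proof (cases "norm w = r")
        case True
        have "w \<bullet> w \<le> 1" "w \<bullet> w > 0"
          using True r that s(1) by (auto simp: dot_square_norm intro: power_le_one)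
        then have "ln (w \<bullet> w) \<le> 0" by (subst ln_le_zero_iff) auto
        then have "\<epsilon> * (- ln (w \<bullet> w)) \<ge> 0" using elim by (simp add: mult_nonneg_nonpos)
        then show ?thesis using bd[OF True] by (simp add: \<psi>_def)
      next
        case False
        then have w: "norm w = s" "w \<in> cball 0 r - {0}" using that s(1) by auto
        have "ln (w \<bullet> w) = 2 * ln s" using w(1) s(1) by (simp add: dot_square_norm ln_realpow)
        then have "\<epsilon> * ln (w \<bullet> w) < m - 1 - B" using s(4) elim by (simp add: field_simps)
        moreover have "p \<bullet> w > - 1"
          using Cauchy_Schwarz_ineq2[of p w] w(1) s(3) by (auto simp: abs_le_iff)
        ultimately show ?thesis using B[OF w(2)] by (simp add: \<psi>_def)
      qed
    qed (use s y in auto)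
    then show ?case by (simp add: \<psi>_def)
  qed
qed

lemma posdef_scaled_identity: "c > 0 \<Longrightarrow> c *\<^sub>R mat 2 \<in> posdef_matrices"
  by (auto simp: posdef_matrices_def sym_matrices_def transpose_def mat_def vec_eq_iff mat_matrix_vector_mult[unfolded mat_def]
     simp flip: scaleR_matrix_vector_assoc)

text \<open>The heart of the argument: for a bounded subharmonic \<open>\<xi>\<close> the comparison principle holds on \<open>E\<close> even if the
differential condition on \<open>\<xi>\<close> says nothing at the origin. Subtracting a logarithmic barrier from \<open>\<xi>\<close>, as
for the Laplacian, is not possible, because subsolutions with respect to \<open>U\<close> cannot be added.

Let \<open>L > 0\<close> be the supremum of \<open>\<xi> - \<phi>\<close>. The comparison principle on the complement of small balls shows
that it can only be approached at the origin. Perturbing \<open>\<phi>\<close> by \<open>- L |w|\<^sup>2\<close> gives a gap of size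
\<open>L \<rho>\<^sup>2\<close> on the sphere of radius \<open>\<rho>\<close>, and this gap leaves room for every linear perturbation \<open>p \<bullet> w\<close> with
\<open>|p| = L \<rho>\<close>, which does not change the Hessian. Choosing \<open>p\<close> opposite to \<open>w\<close> shows
\<open>\<xi> \<le> \<phi> + L - L \<rho> |w|\<close>: the graph of \<open>\<xi>\<close> would have a downward cusp under the smooth function \<open>\<phi> + L\<close> while
reaching it at the origin. A subharmonic function cannot do this. On a small sphere, \<open>\<xi>\<close> lies below the
linearisation of \<open>\<phi> + L\<close> by a fixed amount, and the maximum principle on the punctured ball carries this
amount to the origin, so the supremum of \<open>\<xi> - \<phi>\<close> is less than \<open>L\<close>.\<close>
lemma comparison_across_point:
  fixes \<xi> \<phi> :: "real^'n \<Rightarrow> real"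
  assumes n: "CARD('n) \<ge> 2"
    and U: "\<And>M N. M \<in> U \<Longrightarrow> N \<in> posdef_matrices \<Longrightarrow> M + N \<in> U"
    and \<xi>U: "weak_subsolution_on U (E - {0}) \<xi>"
    and \<xi>tr: "weak_subsolution_on {M. trace M > 0} (E - {0}) \<xi>"
    and E: "compact E" "E \<subseteq> cball 0 1" and D: "open D" "D \<subseteq> E" "0 \<in> D"
    and B: "\<And>w. w \<in> E - {0} \<Longrightarrow> \<xi> w \<le> B"
    and cont: "continuous_on E \<phi>"
    and super: "\<And>z. z \<in> D \<Longrightarrow> \<exists>H. has_hessian \<phi> H z \<and> H \<notin> U"
    and bd: "\<And>w. w \<in> E - D \<Longrightarrow> \<xi> w \<le> \<phi> w"
    and y: "y \<in> E - {0}"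
  shows "\<xi> y \<le> \<phi> y"
proof (rule ccontr)
  assume neg: "\<not> \<xi> y \<le> \<phi> y"
  obtain b where b: "\<And>w. w \<in> E \<Longrightarrow> b \<le> \<phi> w"
    using continuous_attains_inf[OF E(1) _ cont] y by blast
  define L where "L = (SUP w\<in>E - {0}. \<xi> w - \<phi> w)"
  have "bdd_above ((\<lambda>w. \<xi> w - \<phi> w) ` (E - {0}))"
    using B b by (intro bdd_aboveI[of _ "B - b"]) force
  then have L: "\<xi> w \<le> \<phi> w + L" if "w \<in> E - {0}" for w
    using cSUP_upper[of w "E - {0}" "\<lambda>w. \<xi> w - \<phi> w"] that by (simp add: L_def)
  have L0: "L > 0" using L[OF y] neg by simp
  obtain \<rho> where \<rho>: "\<rho> > 0" "cball 0 \<rho> \<subseteq> D"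
    using D(1,3) open_contains_cball by blast
  have \<rho>1: "w \<in> E - {0} \<and> norm w \<le> 1" if "0 < norm w" "norm w \<le> \<rho>" for w
    using that \<rho>(2) D(2) E(2) by force
  have step1: "\<xi> w \<le> \<phi> w + (L - L * (w \<bullet> w))" if w: "w \<in> E - {0}" for w
  proof (rule le_of_eventually_le_add_mult)
    have "\<forall>\<^sub>F r in at_right 0. r < min (min \<rho> (norm w)) 1"
      using w \<rho> by (intro order_tendstoD(2)[OF tendsto_ident_at]) simp
    then show "\<forall>\<^sub>F r in at_right 0. \<xi> w \<le> \<phi> w + (L - L * (w \<bullet> w)) + r * L"
      using eventually_at_right_less[of 0]
    proof eventually_elim
      case (elim r)
      \<comment> \<open>On the inner sphere only \<open>\<xi> \<le> \<phi> + L\<close> is known; the slack \<open>r L\<close> makes up for \<open>L |v|\<^sup>2 = L r\<^sup>2\<close> there.\<close>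
      define \<psi> where "\<psi> v = \<phi> v + ((- L) * (v \<bullet> v) + (L + r * L))" for v
      have "\<xi> w \<le> \<psi> w"
      proof (rule comparison_principle[OF \<xi>U])
        show "compact (E - ball 0 r)" by (intro compact_diff E) auto
        show "open (D - cball 0 r)" by (intro open_Diff D) auto
        show "continuous_on (E - ball 0 r) \<psi>"
          unfolding \<psi>_def by (intro continuous_intros continuous_on_subset[OF cont]) auto
        show "\<exists>H. has_hessian \<psi> H z \<and> H \<notin> U" if "z \<in> D - cball 0 r" for z
        proof -
          obtain H where H: "has_hessian \<phi> H z" "H \<notin> U" using super[of z] \<open>z \<in> _\<close> by blast
          have "has_hessian \<psi> (H + ((- L) *\<^sub>R mat 2 + 0)) z" unfolding \<psi>_def
            by (intro has_hessian_add has_hessian_cmult has_hessian_const has_hessian_square H)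
          moreover have "H + ((- L) *\<^sub>R mat 2 + 0) \<notin> U"
            using U[OF _ posdef_scaled_identity[OF L0], of "H + ((- L) *\<^sub>R mat 2 + 0)"] H(2) by auto
          ultimately show ?thesis by blast
        qed
        show "\<xi> v \<le> \<psi> v" if v: "v \<in> E - ball 0 r - (D - cball 0 r)" for v
        proof (cases "v \<in> D")
          case True
          then have vr: "norm v = r" using v by auto
          have "r\<^sup>2 \<le> r * 1" unfolding power2_eq_square using elim by (intro mult_left_mono) auto
          then have "v \<bullet> v \<le> r" by (simp add: dot_square_norm vr)
          then have "L * (v \<bullet> v) \<le> r * L" using L0 by (simp add: mult.commute[of r])
          then show ?thesis using L[of v] v vr elim by (auto simp: \<psi>_def)
        next
          case False
          have "norm v \<le> 1" using v E(2) by auto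
          then have "v \<bullet> v \<le> 1" by (simp add: dot_square_norm power_le_one)
          then have "L * (v \<bullet> v) \<le> L" "r * L \<ge> 0" using L0 elim by auto
          then show ?thesis using bd[of v] v False by (auto simp: \<psi>_def)
        qed
      qed (use w elim D in auto)
      then show ?case by (simp add: \<psi>_def)
    qed
  qed
  have step2: "\<xi> w \<le> \<phi> w + (L - L * \<rho> * norm w)" if w: "0 < norm w" "norm w \<le> \<rho>" for w
  proof (rule le_of_eventually_le_add_mult)
    \<comment> \<open>The longest vector whose linear function stays above \<open>- L \<rho>\<^sup>2\<close> on the sphere of radius \<open>\<rho>\<close>,
       directed so as to gain most at \<open>w\<close>.\<close>
    define p where "p = (- (L * \<rho> / norm w)) *\<^sub>R w"
    have np: "norm p = L * \<rho>" using w L0 \<rho> by (simp add: p_def)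
    have pw: "p \<bullet> w = - L * \<rho> * norm w"
      using w by (simp add: p_def dot_square_norm power2_eq_square)
    have lower: "p \<bullet> v \<ge> - (L * \<rho> * norm v)" for v
      using Cauchy_Schwarz_ineq2[of p v] by (simp add: np abs_le_iff)
    have "\<forall>\<^sub>F r in at_right 0. r < norm w"
      using w by (intro order_tendstoD(2)[OF tendsto_ident_at]) simp
    then show "\<forall>\<^sub>F r in at_right 0. \<xi> w \<le> \<phi> w + (L - L * \<rho> * norm w) + r * (L * \<rho>)"
      using eventually_at_right_less[of 0]
    proof eventually_elim
      case (elim r)
      define \<psi> where "\<psi> v = \<phi> v + (p \<bullet> v + (L + r * (L * \<rho>)))" for v
      have "\<xi> w \<le> \<psi> w"
      proof (rule comparison_principle[OF \<xi>U])
        show "compact (cball 0 \<rho> - ball 0 r :: (real^'n) set)" by (intro compact_diff) auto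
        show "open (ball 0 \<rho> - cball 0 r :: (real^'n) set)" by (intro open_Diff) auto
        show "cball 0 \<rho> - ball 0 r \<subseteq> E - {0}" using \<rho>(2) D(2) elim by auto
        show "continuous_on (cball 0 \<rho> - ball 0 r) \<psi>"
          unfolding \<psi>_def using \<rho>(2) D(2)
          by (intro continuous_intros continuous_on_subset[OF cont]) auto
        show "\<exists>H. has_hessian \<psi> H z \<and> H \<notin> U" if "z \<in> ball 0 \<rho> - cball 0 r" for z
        proof -
          have "z \<in> D" using that \<rho>(2) by auto
          then obtain H where H: "has_hessian \<phi> H z" "H \<notin> U" using super by blast
          have "has_hessian \<psi> (H + (0 + 0)) z" unfolding \<psi>_def
            by (intro has_hessian_add has_hessian_const has_hessian_inner H)
          with H(2) show ?thesis by auto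
        qed
        show "\<xi> v \<le> \<psi> v" if v: "v \<in> cball 0 \<rho> - ball 0 r - (ball 0 \<rho> - cball 0 r)" for v
        proof -
          have "0 < norm v" "norm v \<le> \<rho>" using v elim by auto
          then have vE: "v \<in> E - {0}" using \<rho>1 by blast
          consider "norm v = \<rho>" | "norm v = r" using v by fastforce
          then show ?thesis
          proof cases
            case 1
            have "L * (v \<bullet> v) = L * \<rho> * norm v" by (simp add: dot_square_norm 1 power2_eq_square)
            moreover have "r * (L * \<rho>) \<ge> 0" using elim L0 \<rho> by simp
            ultimately show ?thesis using step1[OF vE] lower[of v] unfolding \<psi>_def by linarith
          next
            case 2
            then show ?thesis using L[OF vE] lower[of v] by (simp add: \<psi>_def mult_ac)
          qed
        qed
      qed (use w elim in auto)
      then show ?case by (simp add: \<psi>_def pw)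
    qed
  qed
  obtain H where "has_hessian \<phi> H 0" using super[OF D(3)] by blast
  then obtain q where q: "(\<phi> has_derivative (\<lambda>h. q \<bullet> h)) (at 0)"
    by (rule has_hessianE) (use eventually_nhds_x_imp_x in blast)
  have "L * \<rho> / 2 > 0" using L0 \<rho> by simp
  then obtain d where d: "d > 0"
    "\<And>w. norm w < d \<Longrightarrow> \<bar>\<phi> w - \<phi> 0 - q \<bullet> w\<bar> \<le> L * \<rho> / 2 * norm w"
    using q unfolding has_derivative_at_alt by fastforce
  \<comment> \<open>On the sphere of radius \<open>r\<close> the cusp \<open>L \<rho> r\<close> beats the linearisation error \<open>L \<rho> r / 2\<close>.\<close>
  define r where "r = min \<rho> (d / 2)"
  have r: "r > 0" "r \<le> \<rho>" "r < d" using \<rho> d by (auto simp: r_def)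
  have cr: "cball 0 r \<subseteq> E" using r(2) \<rho>(2) D(2) by force
  have step3: "\<xi> w \<le> (\<phi> 0 + L - L * \<rho> * r / 2) + q \<bullet> w" if w: "w \<in> cball 0 r - {0}" for w
  proof (rule punctured_maximum_principle[OF n _ _ _ _ w])
    show "weak_subsolution_on {M. trace M > 0} (cball 0 r - {0}) \<xi>"
      using cr by (intro weak_subsolution_on_subset[OF \<xi>tr]) auto
    show "r \<le> 1"
    proof -
      obtain v :: "real^'n" where "norm v = r" using less_imp_le[OF r(1)] by (rule vector_choose_size)
      then show ?thesis using cr E(2) by force
    qed
    show "\<xi> v \<le> B" if "v \<in> cball 0 r - {0}" for v using that cr by (intro B) auto
    show "\<xi> v \<le> \<phi> 0 + L - L * \<rho> * r / 2 + q \<bullet> v" if v: "norm v = r" for v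
    proof -
      have "\<xi> v \<le> \<phi> v + (L - L * \<rho> * r)" using step2[of v] v r by simp
      moreover have "norm v < d" using v r by simp
      from d(2)[OF this] have "\<phi> v \<le> \<phi> 0 + q \<bullet> v + L * \<rho> / 2 * r" unfolding v by linarith
      ultimately show ?thesis by (simp add: field_simps)
    qed
  qed
  \<comment> \<open>The first term is what is left of \<open>step3\<close> for \<open>|w| \<le> r / 2\<close>, the second is \<open>step1\<close> for the other
     points.\<close>
  define c where "c = min (L * \<rho> * r / 4) (L * (r / 2)\<^sup>2)"
  have c: "c > 0" using L0 \<rho> r by (simp add: c_def)
  have "\<xi> w - \<phi> w \<le> L - c" if w: "w \<in> E - {0}" for w
  proof (cases "norm w \<le> r / 2")
    case True
    then have wr: "norm w \<le> r" "norm w < d" using r by auto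
    have "\<phi> w \<ge> \<phi> 0 + q \<bullet> w - L * \<rho> / 2 * norm w" using d(2)[OF wr(2)] by linarith
    moreover have "L * \<rho> / 2 * norm w \<le> L * \<rho> / 2 * (r / 2)"
      using True L0 \<rho> by (intro mult_left_mono) auto
    moreover have "\<xi> w \<le> (\<phi> 0 + L - L * \<rho> * r / 2) + q \<bullet> w" using step3[of w] w wr by auto
    moreover have "c \<le> L * \<rho> * r / 4" by (simp add: c_def)
    ultimately show ?thesis by (simp add: field_simps)
  next
    case False
    then have "(r / 2)\<^sup>2 \<le> w \<bullet> w" using r by (simp add: dot_square_norm power_mono)
    then have "L * (r / 2)\<^sup>2 \<le> L * (w \<bullet> w)" using L0 by simp
    moreover have "c \<le> L * (r / 2)\<^sup>2" by (simp add: c_def)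
    ultimately show ?thesis using step1[OF w] by simp
  qed
  then have "L \<le> L - c" unfolding L_def using y by (intro cSUP_least) auto
  then show False using c by simp
qed

section \<open>The modulus of continuity\<close>

text \<open>An essential bound of a continuous function on an open set is a bound, since nonempty open sets are not null.\<close>
lemma Linfty_on_continuous_bounded:
  fixes f :: "real^'n \<Rightarrow> real"
  assumes "open S" "continuous_on S f" "Linfty_on S f"
  obtains K where "\<And>x. x \<in> S \<Longrightarrow> \<bar>f x\<bar> \<le> K"
proof -
  obtain K where "AE x in lebesgue_on S. \<bar>f x\<bar> \<le> K"
    using assms(3) by (auto simp: Linfty_on_def)
  then have "AE x in lebesgue. x \<in> S \<longrightarrow> \<bar>f x\<bar> \<le> K"
    using assms(1) by (simp add: AE_restrict_space_iff)
  then obtain N where N: "N \<in> null_sets lebesgue" "{x. \<not> (x \<in> S \<longrightarrow> \<bar>f x\<bar> \<le> K)} \<subseteq> N"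
    by (auto simp: eventually_ae_filter)
  define T where "T = S \<inter> f -` {y. K < \<bar>y\<bar>}"
  have "open T" unfolding T_def
    by (intro continuous_open_preimage assms open_Collect_less continuous_intros)
  moreover have "negligible T"
    using N by (intro negligible_subset[of N T]) (auto simp: negligible_iff_null_sets T_def)
  ultimately have "T = {}" using open_not_negligible by blast
  then have "\<bar>f x\<bar> \<le> K" if "x \<in> S" for x using that by (force simp: T_def)
  then show ?thesis by (rule that)
qed

lemma weak_subsolution_on_hessian:
  assumes "open S" "C0loc_limit_on S \<xi>s \<xi>" "\<And>i. Ck_on 2 S (\<xi>s i)"
    and "\<And>i z N. z \<in> S \<Longrightarrow> N \<in> posdef_matrices \<Longrightarrow> hessian (\<xi>s i) z + N \<in> U"
  shows "weak_subsolution_on U S \<xi>"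
  unfolding weak_subsolution_on_def
  using assms Ck_on_2_has_hessian by blast

lemma trace_posdef:
  assumes "N \<in> posdef_matrices"
  shows "trace (N :: real^'n^'n) > 0"
proof -
  have "N $ i $ i > 0" for i
  proof -
    have "axis i 1 \<bullet> (N *v axis i 1) > 0" using assms by (auto simp: posdef_matrices_def)
    then show ?thesis by (simp add: inner_axis' matrix_vector_mul_component inner_axis)
  qed
  then show ?thesis unfolding trace_def by (intro sum_pos) auto
qed

text \<open>On the sphere of radius \<open>1/2\<close> around \<open>x\<close> the function \<open>\<xi>(x) + a \<eta>(w - x)\<close> with \<open>a = (M - m)/\<mu>\<close> is at
least \<open>\<xi>(x) + M - m \<ge> M\<close>, and at \<open>w = x\<close> it equals \<open>\<xi>(x)\<close>. Its Hessian avoids \<open>U\<close> elsewhere because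
\<open>U\<close> is a cone. Hence it dominates \<open>\<xi>\<close> in the ball, in which \<open>x\<close> belongs to the boundary and the origin is
the isolated singularity of the comparison. The case \<open>m = M\<close> is separate since \<open>a\<close> has to be
positive.\<close>
lemma modulus_near_singularity:
  fixes \<xi> \<eta> :: "real^'n \<Rightarrow> real"
  assumes n: "CARD('n) \<ge> 2" and U: "elliptic_cone U"
    and \<xi>U: "weak_subsolution_on U (ball 0 2 - {0}) \<xi>"
    and \<xi>tr: "weak_subsolution_on {M. trace M > 0} (ball 0 2 - {0}) \<xi>"
    and bounds: "\<And>w. w \<in> ball 0 1 - {0} \<Longrightarrow> m \<le> \<xi> w \<and> \<xi> w \<le> M"
    and \<eta>cont: "continuous_on (ball 0 2) \<eta>" and \<eta>0: "\<eta> 0 = 0"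
    and \<eta>pos: "\<And>w. w \<in> ball 0 2 \<Longrightarrow> \<eta> w \<ge> 0"
    and \<eta>super: "\<And>z. z \<in> ball 0 2 - {0} \<Longrightarrow> \<exists>H. has_hessian \<eta> H z \<and> H \<notin> U"
    and \<mu>: "\<mu> > 0" "\<And>w. norm w = 1 / 2 \<Longrightarrow> \<mu> \<le> \<eta> w"
    and x: "x \<in> ball 0 (1/4) - {0}" and y: "y \<in> ball 0 (1/4) - {0}"
  shows "\<xi> y \<le> \<xi> x + (M - m) / \<mu> * \<eta> (y - x)"
proof (cases "m < M")
  case False
  have "m \<le> \<xi> x" "\<xi> y \<le> M" "m \<le> M" using bounds[of x] bounds[of y] x y by auto
  then show ?thesis using False by simp
next
  case True
  define a where "a = (M - m) / \<mu>"
  have a: "a > 0" using True \<mu>(1) by (simp add: a_def)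
  have near: "w - x \<in> ball 0 2" "w \<noteq> 0 \<Longrightarrow> w \<in> ball 0 1 - {0}" if "w \<in> cball x (1/2)" for w
  proof -
    have "norm (w - x) \<le> 1/2" using that by (simp add: dist_norm norm_minus_commute)
    then show "w - x \<in> ball 0 2" "w \<noteq> 0 \<Longrightarrow> w \<in> ball 0 1 - {0}"
      using x norm_triangle_ineq[of "w - x" x] by auto
  qed
  have Esub: "cball x (1/2) - {0} \<subseteq> ball 0 2 - {0}" using near(2) by force
  have "\<xi> y \<le> \<xi> x + a * \<eta> (y - x)"
  proof (rule comparison_across_point[OF n, where U = U and E = "cball x (1/2)" and D = "ball x (1/2) - {x}"
        and \<xi> = \<xi> and \<phi> = "\<lambda>w. \<xi> x + a * \<eta> (w - x)" and B = M])
    show "M + N \<in> U" if "M \<in> U" "N \<in> posdef_matrices" for M N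
      using U that by (simp add: elliptic_cone_def)
    show "weak_subsolution_on U (cball x (1/2) - {0}) \<xi>"
      by (rule weak_subsolution_on_subset[OF \<xi>U Esub])
    show "weak_subsolution_on {M. trace M > 0} (cball x (1/2) - {0}) \<xi>"
      by (rule weak_subsolution_on_subset[OF \<xi>tr Esub])
    show "cball x (1/2) \<subseteq> cball 0 1" using near(2) by force
    show "open (ball x (1/2) - {x})" by auto
    show "ball x (1/2) - {x} \<subseteq> cball x (1/2)" by auto
    show "0 \<in> ball x (1/2) - {x}" using x by auto
    show "\<xi> w \<le> M" if "w \<in> cball x (1/2) - {0}" for w using near(2)[of w] bounds[of w] that by auto
    show "continuous_on (cball x (1/2)) (\<lambda>w. \<xi> x + a * \<eta> (w - x))"
      using near(1) by (intro continuous_intros continuous_on_compose2[OF \<eta>cont]) auto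
    show "\<exists>H. has_hessian (\<lambda>w. \<xi> x + a * \<eta> (w - x)) H z \<and> H \<notin> U" if "z \<in> ball x (1/2) - {x}" for z
    proof -
      have "z - x \<in> ball 0 2 - {0}" using near(1)[of z] that by auto
      then obtain H where H: "has_hessian \<eta> H (z - x)" "H \<notin> U" using \<eta>super by blast
      have "has_hessian (\<lambda>w. \<xi> x + a * \<eta> (w - x)) (0 + a *\<^sub>R H) z"
        by (intro has_hessian_add has_hessian_cmult has_hessian_const has_hessian_shift H)
      moreover have "0 + a *\<^sub>R H \<notin> U"
      proof
        assume "0 + a *\<^sub>R H \<in> U"
        then have "(1 / a) *\<^sub>R (0 + a *\<^sub>R H) \<in> U"
          using U a unfolding elliptic_cone_def by (meson zero_less_divide_1_iff)
        then show False using H(2) a by simp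
      qed
      ultimately show ?thesis by blast
    qed
    show "\<xi> w \<le> \<xi> x + a * \<eta> (w - x)" if w: "w \<in> cball x (1/2) - (ball x (1/2) - {x})" for w
    proof (cases "w = x")
      case False
      then have d: "norm (w - x) = 1/2" using w by (auto simp: dist_norm norm_minus_commute)
      then have "w \<noteq> 0" using x by auto
      then have "\<xi> w \<le> M" using near(2)[of w] bounds[of w] w by auto
      moreover have "m \<le> \<xi> x" using bounds[of x] x by auto
      moreover have "M - m \<le> a * \<eta> (w - x)"
      proof -
        have "M - m = a * \<mu>" using \<mu>(1) by (simp add: a_def)
        also have "\<dots> \<le> a * \<eta> (w - x)" using a \<mu>(2)[OF d] by simp
        finally show ?thesis .
      qed
      ultimately show ?thesis by simp
    qed (simp add: \<eta>0)
    show "y \<in> cball x (1/2) - {0}"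
      using x y norm_triangle_ineq4[of x y] by (auto simp: dist_norm)
  qed auto
  then show ?thesis by (simp add: a_def)
qed

text \<open>The oscillation bound tends to \<open>0\<close> with \<open>x - y\<close>, so \<open>\<xi>\<close> is uniformly continuous near the origin and has a
limit there. The bound for pairs that contain the origin is obtained by passing to this limit.\<close>
lemma continuous_extension_at_0:
  fixes \<xi> \<eta> :: "real^'n \<Rightarrow> real"
  assumes r: "r > 0" "r \<le> R"
    and \<xi>: "continuous_on (ball 0 R - {0}) \<xi>"
    and \<eta>: "continuous_on (ball 0 (2 * r)) \<eta>" "\<eta> 0 = 0"
    and osc: "\<And>x y. x \<in> ball 0 r - {0} \<Longrightarrow> y \<in> ball 0 r - {0} \<Longrightarrow>
       \<bar>\<xi> x - \<xi> y\<bar> \<le> A * (\<eta> (x - y) + \<eta> (y - x))"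
  obtains \<zeta> where "\<And>x. x \<noteq> 0 \<Longrightarrow> \<zeta> x = \<xi> x" "continuous_on (ball 0 R) \<zeta>"
    "\<And>x y. x \<in> ball 0 r \<Longrightarrow> y \<in> ball 0 r \<Longrightarrow> \<bar>\<zeta> x - \<zeta> y\<bar> \<le> A * (\<eta> (x - y) + \<eta> (y - x))"
proof -
  let ?P = "ball 0 r - {0} :: (real^'n) set"
  have at0: "at 0 within ?P = at (0 :: real^'n)"
  proof -
    have "at 0 within ?P = at 0 within ball (0 :: real^'n) r" by (simp add: at_within_def)
    also have "\<dots> = at 0" using r by (intro at_within_open) auto
    finally show ?thesis .
  qed
  have \<eta>c: "isCont \<eta> w" if "norm w < 2 * r" for w
    using \<eta>(1) that by (simp add: continuous_on_eq_continuous_at)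
  have "uniformly_continuous_on ?P \<xi>"
    unfolding uniformly_continuous_on_def
  proof (intro allI impI)
    fix \<epsilon> :: real assume \<epsilon>: "\<epsilon> > 0"
    have "((\<lambda>w. A * (\<eta> (- w) + \<eta> w)) \<longlongrightarrow> A * (\<eta> (- 0) + \<eta> 0)) (at 0)"
      by (intro tendsto_intros isCont_tendsto_compose[OF \<eta>c]) (use r in auto)
    then have "\<forall>\<^sub>F w in at 0. A * (\<eta> (- w) + \<eta> w) < \<epsilon>"
      by (rule order_tendstoD(2)) (use \<epsilon> \<eta>(2) in auto)
    then obtain d where d: "d > 0" "\<And>w. w \<noteq> 0 \<Longrightarrow> norm w < d \<Longrightarrow> A * (\<eta> (- w) + \<eta> w) < \<epsilon>"
      by (auto simp: eventually_at)
    have "dist (\<xi> y) (\<xi> x) < \<epsilon>" if "x \<in> ?P" "y \<in> ?P" "dist y x < d" for x y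
    proof (cases "x = y")
      case False
      then show ?thesis using osc[of x y] that d(2)[of "y - x"]
        by (simp add: dist_norm abs_minus_commute)
    qed (use \<epsilon> in simp)
    then show "\<exists>d>0. \<forall>x\<in>?P. \<forall>y\<in>?P. dist y x < d \<longrightarrow> dist (\<xi> y) (\<xi> x) < \<epsilon>"
      using d(1) by blast
  qed
  moreover have "0 islimpt ?P" using trivial_limit_within[of 0 ?P] unfolding at0 by simp
  then have "0 \<in> closure ?P" by (simp add: closure_def)
  ultimately obtain l where "(\<xi> \<longlongrightarrow> l) (at 0 within ?P)"
    by (rule uniformly_continuous_on_extension_at_closure)
  then have l: "(\<xi> \<longlongrightarrow> l) (at 0)" by (simp only: at0)
  have osc0: "\<bar>l - \<xi> y\<bar> \<le> A * (\<eta> (0 - y) + \<eta> (y - 0))" if y: "y \<in> ?P" for y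
  proof (rule tendsto_le[of "at (0 :: real^'n)"])
    show "((\<lambda>x. \<bar>\<xi> x - \<xi> y\<bar>) \<longlongrightarrow> \<bar>l - \<xi> y\<bar>) (at 0)" by (intro tendsto_intros l)
    show "((\<lambda>x. A * (\<eta> (x - y) + \<eta> (y - x))) \<longlongrightarrow> A * (\<eta> (0 - y) + \<eta> (y - 0))) (at 0)"
      by (intro tendsto_intros isCont_tendsto_compose[OF \<eta>c]) (use y r in auto)
    have "\<forall>\<^sub>F x in at 0. x \<in> ?P" unfolding at0[symmetric] by (simp add: eventually_at_filter)
    then show "\<forall>\<^sub>F x in at 0. \<bar>\<xi> x - \<xi> y\<bar> \<le> A * (\<eta> (x - y) + \<eta> (y - x))"
      by eventually_elim (use osc y in auto)
  qed auto
  define \<zeta> where "\<zeta> x = (if x = 0 then l else \<xi> x)" for x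
  show ?thesis
  proof
    show "\<zeta> x = \<xi> x" if "x \<noteq> 0" for x using that by (simp add: \<zeta>_def)
    have "isCont \<zeta> x" if "x \<in> ball 0 R" for x
    proof (cases "x = 0")
      case True
      have "(\<zeta> \<longlongrightarrow> l) (at 0)"
        using l by (rule Lim_transform_eventually) (simp add: \<zeta>_def eventually_at_filter)
      then show ?thesis using True by (simp add: isCont_def \<zeta>_def)
    next
      case False
      then have x: "x \<in> ball 0 R - {0}" using that by simp
      have o: "open (ball 0 R - {0} :: (real^'n) set)" by auto
      have "isCont \<xi> x" using \<xi> x o by (simp only: continuous_on_eq_continuous_at)
      moreover have "\<forall>\<^sub>F w in nhds x. \<zeta> w = \<xi> w"
        using eventually_nhds_in_open[OF o x] by eventually_elim (simp add: \<zeta>_def)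
      ultimately show ?thesis by (simp add: isCont_cong)
    qed
    then show "continuous_on (ball 0 R) \<zeta>" by (simp add: continuous_at_imp_continuous_on)
    show "\<bar>\<zeta> x - \<zeta> y\<bar> \<le> A * (\<eta> (x - y) + \<eta> (y - x))" if "x \<in> ball 0 r" "y \<in> ball 0 r" for x y
    proof -
      consider "x = 0" "y = 0" | "x = 0" "y \<noteq> 0" | "x \<noteq> 0" "y = 0" | "x \<noteq> 0" "y \<noteq> 0" by blast
      then show ?thesis
      proof cases
        case 2
        then show ?thesis using osc0[of y] that by (simp add: \<zeta>_def)
      next
        case 3
        then show ?thesis using osc0[of x] that by (simp add: \<zeta>_def abs_minus_commute add.commute)
      next
        case 4
        then show ?thesis using osc[of x y] that by (simp add: \<zeta>_def)
      qed (simp add: \<zeta>_def \<eta>(2))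
    qed
  qed
qed

theorem theorem1p5:
  fixes \<eta> :: "real^'n \<Rightarrow> real"
  assumes "CARD('n) \<ge> 3"
    and "Ck_on 2 (ball 0 2 - {0}) \<eta>"
    and "continuous_on (ball 0 2) \<eta>"
    and "\<eta> 0 = 0"
    and "\<forall>x \<in> ball 0 2 - {0}. \<eta> x > 0"
  shows "\<exists>C>0. \<forall>(U :: (real^'n^'n) set) (\<xi> :: real^'n \<Rightarrow> real) (\<xi>s :: nat \<Rightarrow> real^'n \<Rightarrow> real).
    elliptic_cone U \<and>
    (\<forall>x \<in> ball 0 2 - {0}. hessian \<eta> x \<notin> U) \<and>
    continuous_on (ball 0 2 - {0}) \<xi> \<and>
    Linfty_on (ball 0 2 - {0}) \<xi> \<and>
    (\<forall>x \<in> ball 0 2 - {0}. \<xi> x > 0) \<and>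
    distr_laplacian_nonneg_on (ball 0 2 - {0}) \<xi> \<and>
    (\<forall>i. Ck_on 2 (ball 0 2 - {0}) (\<xi>s i) \<and>
         (\<forall>x \<in> ball 0 2 - {0}. laplacian (\<xi>s i) x \<ge> 0 \<and> hessian (\<xi>s i) x \<in> closure U)) \<and>
    C0loc_limit_on (ball 0 2 - {0}) \<xi>s \<xi>
    \<longrightarrow>
    (\<exists>\<zeta> :: real^'n \<Rightarrow> real.
       (\<forall>x \<in> ball 0 2 - {0}. \<zeta> x = \<xi> x) \<and>
       continuous_on (ball 0 1) \<zeta> \<and>
       (\<exists>z \<in> sphere 0 1. (\<forall>y \<in> sphere 0 1. \<xi> y \<le> \<xi> z) \<and>
          (SUP x\<in>ball 0 1 - {0}. \<xi> x) \<le> \<xi> z) \<and>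
       (\<forall>x \<in> ball 0 (1/4). \<forall>y \<in> ball 0 (1/4).
          \<bar>\<zeta> x - \<zeta> y\<bar> \<le>
            C * ((SUP x\<in>ball 0 1 - {0}. \<xi> x) - (INF x\<in>ball 0 1 - {0}. \<xi> x))
              * (\<eta> (x - y) + \<eta> (y - x))))"
proof -
  note \<eta>C2 = assms(2) and \<eta>cont = assms(3) and \<eta>0 = assms(4) and \<eta>pos = assms(5)
  have n: "CARD('n) \<ge> 2" using assms(1) by simp
  let ?S = "ball 0 2 - {0} :: (real^'n) set"
  let ?B = "ball 0 1 - {0} :: (real^'n) set"
  have S: "open ?S" by auto
  have sphere_ne: "sphere (0 :: real^'n) r \<noteq> {}" if r: "r \<ge> 0" for r
  proof -
    obtain v :: "real^'n" where "norm v = r" using r by (rule vector_choose_size)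
    then show ?thesis by (intro ex_in_conv[THEN iffD1] exI[of _ v]) simp
  qed
  have "continuous_on (sphere 0 (1/2)) \<eta>"
    by (rule continuous_on_subset[OF \<eta>cont]) auto
  from continuous_attains_inf[OF compact_sphere sphere_ne[of "1/2"] this] obtain e where e: "e \<in> sphere 0 (1/2)" "\<And>w. w \<in> sphere 0 (1/2) \<Longrightarrow> \<eta> e \<le> \<eta> w"
    by (metis zero_le_divide_1_iff zero_le_numeral)
  have "e \<in> ?S" using e(1) by auto
  then have \<mu>: "\<eta> e > 0" using \<eta>pos by blast
  have \<eta>nonneg: "\<eta> w \<ge> 0" if "w \<in> ball 0 2" for w
    using \<eta>pos \<eta>0 that by (cases "w = 0") (auto intro: less_imp_le)
  show ?thesis
  proof (intro exI[of _ "1 / \<eta> e"] conjI allI impI)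
    show "0 < 1 / \<eta> e" using \<mu> by simp
    fix U :: "(real^'n^'n) set" and \<xi> and \<xi>s :: "nat \<Rightarrow> real^'n \<Rightarrow> real"
    assume h: "elliptic_cone U \<and>
      (\<forall>x \<in> ball 0 2 - {0}. hessian \<eta> x \<notin> U) \<and>
      continuous_on (ball 0 2 - {0}) \<xi> \<and>
      Linfty_on (ball 0 2 - {0}) \<xi> \<and>
      (\<forall>x \<in> ball 0 2 - {0}. \<xi> x > 0) \<and>
      distr_laplacian_nonneg_on (ball 0 2 - {0}) \<xi> \<and>
      (\<forall>i. Ck_on 2 (ball 0 2 - {0}) (\<xi>s i) \<and>
           (\<forall>x \<in> ball 0 2 - {0}. laplacian (\<xi>s i) x \<ge> 0 \<and> hessian (\<xi>s i) x \<in> closure U)) \<and>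
      C0loc_limit_on (ball 0 2 - {0}) \<xi>s \<xi>"
    then have U: "elliptic_cone U" and \<xi>cont: "continuous_on ?S \<xi>" by auto
    have \<xi>U: "weak_subsolution_on U ?S \<xi>"
      using h by (intro weak_subsolution_on_hessian[OF S, of \<xi>s])
        (auto intro: elliptic_cone_closure_add_posdef[OF U])
    have \<xi>tr: "weak_subsolution_on {M. trace M > 0} ?S \<xi>"
      using h by (intro weak_subsolution_on_hessian[OF S, of \<xi>s])
        (auto simp: trace_add laplacian_eq_trace_hessian intro!: add_nonneg_pos trace_posdef)
    obtain K where K: "\<And>w. w \<in> ?S \<Longrightarrow> \<bar>\<xi> w\<bar> \<le> K"
      using Linfty_on_continuous_bounded[OF S \<xi>cont] h by blast
    define M where "M = (SUP w\<in>?B. \<xi> w)"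
    define m where "m = (INF w\<in>?B. \<xi> w)"
    have bounds: "m \<le> \<xi> w \<and> \<xi> w \<le> M" if "w \<in> ?B" for w
    proof -
      have "- K \<le> \<xi> v" "\<xi> v \<le> K" if "v \<in> ?B" for v
        using K[of v] that by (auto simp: abs_le_iff)
      then have "bdd_above (\<xi> ` ?B)" "bdd_below (\<xi> ` ?B)"
        by (intro bdd_aboveI2[of _ _ K] bdd_belowI2[of _ "- K"]; blast)+
      then show ?thesis using that by (auto simp: M_def m_def intro: cSUP_upper cINF_lower)
    qed
    have "continuous_on (sphere 0 1) \<xi>" by (rule continuous_on_subset[OF \<xi>cont]) auto
    from continuous_attains_sup[OF compact_sphere sphere_ne[of 1] this] obtain z where z: "z \<in> sphere 0 1" "\<forall>y\<in>sphere 0 1. \<xi> y \<le> \<xi> z"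
      by (metis zero_le_one)
    have zmax: "\<xi> w \<le> \<xi> z" if w: "w \<in> ?B" for w
    proof -
      have "\<xi> w \<le> \<xi> z + 0 \<bullet> w"
      proof (rule punctured_maximum_principle[OF n, where r = 1 and B = K])
        show "weak_subsolution_on {M. trace M > 0} (cball 0 1 - {0}) \<xi>"
          by (rule weak_subsolution_on_subset[OF \<xi>tr]) auto
        show "\<xi> v \<le> K" if "v \<in> cball 0 1 - {0}" for v using K[of v] that by auto
      qed (use z w in auto)
      then show ?thesis by simp
    qed
    have eB: "e \<in> ?B" using e(1) by auto
    then have Mz: "M \<le> \<xi> z" unfolding M_def by (intro cSUP_least zmax) auto
    have half: "\<xi> y \<le> \<xi> x + (M - m) / \<eta> e * \<eta> (y - x)"
      if "x \<in> ball 0 (1/4) - {0}" "y \<in> ball 0 (1/4) - {0}" for x y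
    proof (rule modulus_near_singularity[OF n U \<xi>U \<xi>tr bounds \<eta>cont \<eta>0 \<eta>nonneg _ \<mu> _ that])
      show "\<exists>H. has_hessian \<eta> H w \<and> H \<notin> U" if "w \<in> ?S" for w
        using Ck_on_2_has_hessian[OF S \<eta>C2 that] h that by blast
      show "\<eta> e \<le> \<eta> w" if "norm w = 1/2" for w using e(2)[of w] that by simp
    qed
    have mM: "m \<le> M" using bounds[OF eB] by linarith
    obtain \<zeta> where \<zeta>: "\<And>x. x \<noteq> 0 \<Longrightarrow> \<zeta> x = \<xi> x" "continuous_on (ball 0 1) \<zeta>"
      "\<And>x y. x \<in> ball 0 (1/4) \<Longrightarrow> y \<in> ball 0 (1/4) \<Longrightarrow>
         \<bar>\<zeta> x - \<zeta> y\<bar> \<le> (M - m) / \<eta> e * (\<eta> (x - y) + \<eta> (y - x))"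
    proof (rule continuous_extension_at_0[of "1/4" 1 \<xi> \<eta> "(M - m) / \<eta> e"])
      show "continuous_on ?B \<xi>" by (rule continuous_on_subset[OF \<xi>cont]) auto
      show "continuous_on (ball 0 (2 * (1/4))) \<eta>" by (rule continuous_on_subset[OF \<eta>cont]) auto
      show "\<bar>\<xi> x - \<xi> y\<bar> \<le> (M - m) / \<eta> e * (\<eta> (x - y) + \<eta> (y - x))"
        if x: "x \<in> ball 0 (1/4) - {0}" and y: "y \<in> ball 0 (1/4) - {0}" for x y
      proof -
        have "x - y \<in> ball 0 2" "y - x \<in> ball 0 2"
          using x y norm_triangle_ineq4[of x y] by (auto simp: norm_minus_commute)
        then have "(M - m) / \<eta> e * \<eta> (x - y) \<ge> 0" "(M - m) / \<eta> e * \<eta> (y - x) \<ge> 0"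
          using \<mu> mM \<eta>nonneg by auto
        then show ?thesis using half[OF x y] half[OF y x]
          by (simp only: distrib_left abs_le_iff) linarith
      qed
    qed (auto simp: \<eta>0)
    show "\<exists>\<zeta> :: real^'n \<Rightarrow> real.
       (\<forall>x \<in> ball 0 2 - {0}. \<zeta> x = \<xi> x) \<and>
       continuous_on (ball 0 1) \<zeta> \<and>
       (\<exists>z \<in> sphere 0 1. (\<forall>y \<in> sphere 0 1. \<xi> y \<le> \<xi> z) \<and>
          (SUP x\<in>ball 0 1 - {0}. \<xi> x) \<le> \<xi> z) \<and>
       (\<forall>x \<in> ball 0 (1/4). \<forall>y \<in> ball 0 (1/4).
          \<bar>\<zeta> x - \<zeta> y\<bar> \<le>
            1 / \<eta> e * ((SUP x\<in>ball 0 1 - {0}. \<xi> x) - (INF x\<in>ball 0 1 - {0}. \<xi> x))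
              * (\<eta> (x - y) + \<eta> (y - x)))"
    proof (intro exI[of _ \<zeta>] conjI ballI)
      show "\<exists>z \<in> sphere 0 1. (\<forall>y \<in> sphere 0 1. \<xi> y \<le> \<xi> z) \<and> (SUP x\<in>?B. \<xi> x) \<le> \<xi> z"
        using z Mz unfolding M_def by blast
      show "\<bar>\<zeta> x - \<zeta> y\<bar> \<le> 1 / \<eta> e * ((SUP x\<in>?B. \<xi> x) - (INF x\<in>?B. \<xi> x)) * (\<eta> (x - y) + \<eta> (y - x))"
        if "x \<in> ball 0 (1/4)" "y \<in> ball 0 (1/4)" for x y
        using \<zeta>(3)[OF that] by (simp add: M_def m_def)
    qed (use \<zeta> in auto)
  qed
qed

end
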